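(* Let $G$ be a three-dimensional real Lie algebra. If $G$ is solvable, then its commutator algebra $G'=[G,G]$ is abelian. Moreover, for solvable $G$: (a) if $G'$ is two-dimensional, then the structure of $G$ is completely determined by the eigenvalues and multiplicities of $\mathrm{ad}(X)$ as a linear transformation of $G'$, where $X\in G$ is any representative of a nonzero element of the one-dimensional quotient $G/G'$. That is, if $G_1,G_2$ are three-dimensional solvable real Lie algebras with $\dim G_1'=\dim G_2'=2$, and there are $X_i\in G_i\setminus G_i'$ ($i=1,2$) such that $\mathrm{ad}(X_1)|_{G_1'}$ and $\mathrm{ad}(X_2)|_{G_2'}$ have the same (complex) eigenvalues with the same algebraic and geometric multiplicities, then $G_1\cong G_2$; (b) if $G'$ is one-dimensional, then the structure of $G$ is completely determined by the dimension of the centralizer $Z_G(G')$ of $G'$ in $G$. That is, if $G_1,G_2$ are three-dimensional solvable real Lie algebras with $\dim G_1'=\dim G_2'=1$ and $\dim Z_{G_1}(G_1')=\dim Z_{G_2}(G_2')$, then $G_1\cong G_2$.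
   Context: Lie algebras are over $\mathbb{R}$. $G'=[G,G]$ denotes the commutator (derived) algebra of $G$; $\mathrm{ad}(X)(Y)=[X,Y]$; and $Z_G(G')=\{W\in G : [W,U]=0 \text{ for all } U\in G'\}$ is the centralizer of $G'$ in $G$. Eigenvalues of $\mathrm{ad}(X)|_{G'}$ are taken in $\mathbb{C}$, that is, on the complexification of $G'$. *)

theory Defs
  imports "HOL-Analysis.Linear_Algebra" "Jordan_Normal_Form.Char_Poly"
begin

section \<open>Real Lie algebras\<close>

text \<open>A real Lie algebra is the whole type \<open>'a::real_vector\<close> together with its bracket.\<close>

locale lie_algebra =
  fixes br :: "'a::real_vector \<Rightarrow> 'a \<Rightarrow> 'a"
  assumes bilinear: "bilinear br"
    and alternating: "br x x = 0"
    and jacobi: "br x (br y z) + br y (br z x) + br z (br x y) = 0"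

text \<open>For \<open>n > 0\<close>, \<open>dim UNIV = n\<close> entails finite dimension, since \<open>dim\<close> is the
  cardinality of a basis and infinite sets have cardinality 0.\<close>

definition lie_product :: "('a::real_vector \<Rightarrow> 'a \<Rightarrow> 'a) \<Rightarrow> 'a set \<Rightarrow> 'a set \<Rightarrow> 'a set" where
  "lie_product br A B = span {br x y | x y. x \<in> A \<and> y \<in> B}"

definition derived_algebra :: "('a::real_vector \<Rightarrow> 'a \<Rightarrow> 'a) \<Rightarrow> 'a set" where
  "derived_algebra br = lie_product br UNIV UNIV"

primrec derived_series :: "('a::real_vector \<Rightarrow> 'a \<Rightarrow> 'a) \<Rightarrow> nat \<Rightarrow> 'a set" where
  "derived_series br 0 = UNIV"
| "derived_series br (Suc n) = lie_product br (derived_series br n) (derived_series br n)"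

definition solvable_lie :: "('a::real_vector \<Rightarrow> 'a \<Rightarrow> 'a) \<Rightarrow> bool" where
  "solvable_lie br \<longleftrightarrow> (\<exists>n. derived_series br n = {0})"

definition abelian_on :: "('a::real_vector \<Rightarrow> 'a \<Rightarrow> 'a) \<Rightarrow> 'a set \<Rightarrow> bool" where
  "abelian_on br H \<longleftrightarrow> (\<forall>x\<in>H. \<forall>y\<in>H. br x y = 0)"

definition ad :: "('a::real_vector \<Rightarrow> 'a \<Rightarrow> 'a) \<Rightarrow> 'a \<Rightarrow> 'a \<Rightarrow> 'a" where
  "ad br x = (\<lambda>y. br x y)"

definition lie_centralizer :: "('a::real_vector \<Rightarrow> 'a \<Rightarrow> 'a) \<Rightarrow> 'a set \<Rightarrow> 'a set" where
  "lie_centralizer br H = {w. \<forall>u\<in>H. br w u = 0}"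

definition lie_isomorphic ::
  "('a::real_vector \<Rightarrow> 'a \<Rightarrow> 'a) \<Rightarrow> ('b::real_vector \<Rightarrow> 'b \<Rightarrow> 'b) \<Rightarrow> bool" where
  "lie_isomorphic br1 br2 \<longleftrightarrow>
     (\<exists>f. linear f \<and> bij f \<and> (\<forall>x y. f (br1 x y) = br2 (f x) (f y)))"


section \<open>Complex eigenvalues of a real linear map on an invariant subspace\<close>

text \<open>The complexification of \<open>V\<close> is \<open>V \<times> V\<close>, where \<open>(u, v)\<close> stands for \<open>u + i v\<close>;
  the complexification of a real linear map \<open>T\<close> is \<open>map_prod T T\<close>.\<close>

definition cscale :: "complex \<Rightarrow> 'a::real_vector \<times> 'a \<Rightarrow> 'a \<times> 'a" where
  "cscale c w = (Re c *\<^sub>R fst w - Im c *\<^sub>R snd w, Re c *\<^sub>R snd w + Im c *\<^sub>R fst w)"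

global_interpretation cplx: vector_space "cscale :: complex \<Rightarrow> 'a::real_vector \<times> 'a \<Rightarrow> 'a \<times> 'a"
  by unfold_locales (auto simp: cscale_def algebra_simps)

definition complex_eigenspace ::
  "'a::real_vector set \<Rightarrow> ('a \<Rightarrow> 'a) \<Rightarrow> complex \<Rightarrow> ('a \<times> 'a) set" where
  "complex_eigenspace V T c = {w \<in> V \<times> V. map_prod T T w = cscale c w}"

definition complex_eigenvalues :: "'a::real_vector set \<Rightarrow> ('a \<Rightarrow> 'a) \<Rightarrow> complex set" where
  "complex_eigenvalues V T = {c. \<exists>w \<in> complex_eigenspace V T c. w \<noteq> 0}"

definition geometric_mult :: "'a::real_vector set \<Rightarrow> ('a \<Rightarrow> 'a) \<Rightarrow> complex \<Rightarrow> nat" where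
  "geometric_mult V T c = cplx.dim (complex_eigenspace V T c)"

definition ordered_basis :: "'a::real_vector set \<Rightarrow> 'a list \<Rightarrow> bool" where
  "ordered_basis V bs \<longleftrightarrow> distinct bs \<and> independent (set bs) \<and> span (set bs) = V"

text \<open>Column \<open>j\<close> holds the coordinates of \<open>T (bs ! j)\<close> with respect to \<open>bs\<close>.\<close>

definition matrix_wrt :: "'a::real_vector list \<Rightarrow> ('a \<Rightarrow> 'a) \<Rightarrow> real mat" where
  "matrix_wrt bs T = Matrix.mat (length bs) (length bs)
     (\<lambda>(i, j). representation (set bs) (T (bs ! j)) (bs ! i))"

text \<open>Only meaningful for a finite-dimensional subspace \<open>V\<close> invariant under \<open>T\<close>;
  the polynomial then does not depend on the chosen basis.\<close>

definition char_poly_on :: "'a::real_vector set \<Rightarrow> ('a \<Rightarrow> 'a) \<Rightarrow> real poly" where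
  "char_poly_on V T = char_poly (matrix_wrt (SOME bs. ordered_basis V bs) T)"

definition algebraic_mult :: "'a::real_vector set \<Rightarrow> ('a \<Rightarrow> 'a) \<Rightarrow> complex \<Rightarrow> nat" where
  "algebraic_mult V T c = Polynomial.order c (map_poly complex_of_real (char_poly_on V T))"

definition same_eigenvalues_and_mults ::
  "'a::real_vector set \<Rightarrow> ('a \<Rightarrow> 'a) \<Rightarrow> 'b::real_vector set \<Rightarrow> ('b \<Rightarrow> 'b) \<Rightarrow> bool" where
  "same_eigenvalues_and_mults V S W T \<longleftrightarrow>
     complex_eigenvalues V S = complex_eigenvalues W T \<and>
     (\<forall>c \<in> complex_eigenvalues V S.
        algebraic_mult V S c = algebraic_mult W T c \<and>
        geometric_mult V S c = geometric_mult W T c)"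

end

theory Submission
  imports Defs
begin

text \<open>Every solvable real Lie algebra of dimension three whose derived algebra \<open>D\<close> has dimension one
  or two is a semidirect product of a line with an abelian plane. Hence it has a basis
  \<open>x, y, z\<close> with \<open>br y z = 0\<close> in which \<open>ad x\<close> acts on the span of \<open>y\<close> and \<open>z\<close> by a two by two
  matrix (definition \<open>semidirect_basis\<close>), and algebras that admit the same matrix are isomorphic
  (\<open>lie_isomorphic_of_semidirect_bases\<close>). Each case of the classification comes down to a normal form
  of that matrix which the given invariants determine.

  \<^emph>\<open>\<open>D\<close> is abelian\<close> (\<open>derived_algebra_abelian\<close>). Solvability makes \<open>D\<close> a proper subspace. If \<open>D\<close> were
  not abelian, it would be a plane with a basis \<open>w, t\<close> such that \<open>br w t = w\<close>. The Jacobi identity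
  for \<open>w\<close>, \<open>t\<close> and some \<open>X\<close> outside \<open>D\<close> then shows that \<open>br X w\<close> and \<open>br X t\<close> are multiples
  of \<open>w\<close>, so that \<open>D\<close> would be the line of \<open>w\<close> after all.

  \<^emph>\<open>\<open>D\<close> is a line\<close> (\<open>semidirect_basis_of_derived_line\<close>). If \<open>D\<close> is central, then two elements with
  nonzero bracket, together with that bracket, exhibit the Heisenberg algebra. Otherwise some \<open>x\<close>
  satisfies \<open>br x y = y\<close> with \<open>y\<close> spanning \<open>D\<close>, and any third basis vector can be corrected to be
  central. The centralizer of \<open>D\<close> has dimension three in the first case only.

  \<^emph>\<open>\<open>D\<close> is a plane\<close> (\<open>semidirect_basis_of_derived_plane\<close>). On \<open>D\<close>, the map \<open>T = ad X\<close> is either a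
  scalar or has a cyclic vector \<open>v\<close>; in the latter case its matrix in the basis \<open>v, T v\<close> is the companion matrix of its
  characteristic polynomial \<open>c\<^sup>2 - t c + d\<close>. A scalar map has an eigenvalue of geometric
  multiplicity two, a cyclic one has none. The set of eigenvalues determines the scalar in
  the first case, and \<open>t\<close> and \<open>d\<close> in the second, because a monic quadratic polynomial with a
  single root has it as a double root.\<close>

section \<open>Bases and coordinates\<close>

lemma span_eq_of_card_eq_dim:
  fixes V :: "'v::real_vector set"
  assumes "subspace V" "dim V = n" "n > 0"
    and "B \<subseteq> V" "independent B" "card B = n"
  shows "span B = V"
proof -
  obtain C where C: "C \<subseteq> V" "independent C" "V \<subseteq> span C" "card C = n"
    using basis_exists[of V] assms(2) by auto
  have fin: "finite C" using C(4) assms(3) card_ge_0_finite by auto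
  have finB: "finite B" using assms(3,6) card_ge_0_finite by auto
  have "w \<in> span B" if w: "w \<in> V" for w
  proof (rule ccontr)
    assume "w \<notin> span B"
    then have ind: "independent (insert w B)" and "w \<notin> B"
      using assms(5) by (auto simp: independent_insert span_base)
    have "insert w B \<subseteq> span C" using C(3) w assms(4) by auto
    then have "card (insert w B) \<le> card C"
      using independent_span_bound[OF fin ind] by blast
    then show False using \<open>w \<notin> B\<close> finB C(4) assms(6) by simp
  qed
  then show ?thesis using span_minimal[OF assms(4,1)] by blast
qed

lemma in_span_pair:
  fixes y z :: "'v::real_vector"
  shows "u \<in> span {y, z} \<longleftrightarrow> (\<exists>b c. u = b *\<^sub>R y + c *\<^sub>R z)"
proof -
  have "u \<in> span {y, z} \<longleftrightarrow> (\<exists>b c. u - b *\<^sub>R y = c *\<^sub>R z)"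
    by (auto simp: span_insert[of y] span_singleton)
  then show ?thesis by (simp add: algebra_simps)
qed

lemma in_span_triple:
  fixes x y z :: "'v::real_vector"
  shows "u \<in> span {x, y, z} \<longleftrightarrow> (\<exists>a b c. u = a *\<^sub>R x + b *\<^sub>R y + c *\<^sub>R z)"
proof -
  have "u \<in> span {x, y, z} \<longleftrightarrow> (\<exists>a b c. u - a *\<^sub>R x = b *\<^sub>R y + c *\<^sub>R z)"
    by (subst span_insert) (auto simp: in_span_pair)
  then show ?thesis by (simp add: algebra_simps)
qed

lemma independent_pairI:
  fixes y z :: "'v::real_vector"
  assumes "\<And>b c. b *\<^sub>R y + c *\<^sub>R z = 0 \<Longrightarrow> b = 0 \<and> c = 0"
  shows "y \<noteq> z \<and> independent {y, z}"
proof -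
  have z: "z \<noteq> 0" using assms[of 0 1] by auto
  have y: "y \<notin> span {z}"
  proof
    assume "y \<in> span {z}"
    then obtain k where "y = k *\<^sub>R z" by (auto simp: span_singleton)
    then show False using assms[of 1 "-k"] by simp
  qed
  have "y \<noteq> z" using y span_base[of z "{z}"] by auto
  then show ?thesis using y z by (simp add: independent_insert)
qed

lemma independent_pairD:
  fixes y z :: "'v::real_vector"
  assumes "y \<noteq> z" "independent {y, z}" "b *\<^sub>R y + c *\<^sub>R z = 0"
  shows "b = 0 \<and> c = 0"
proof -
  have y: "y \<notin> span {z}" and z: "z \<noteq> 0"
    using assms(1,2) by (auto simp: independent_insert)
  have "b = 0"
  proof (rule ccontr)
    assume b: "b \<noteq> 0"
    have "b *\<^sub>R y = (-c) *\<^sub>R z" using assms(3) by (simp add: add_eq_0_iff2)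
    then have "(1 / b) *\<^sub>R (b *\<^sub>R y) = (1 / b) *\<^sub>R ((-c) *\<^sub>R z)" by (rule arg_cong)
    then have "y = (- c / b) *\<^sub>R z" using b by simp
    then have "y \<in> span {z}" unfolding span_singleton by (rule range_eqI)
    then show False using y by contradiction
  qed
  then show ?thesis using assms(3) z by simp
qed

lemma ordered_basis_tripleI:
  fixes x y z :: "'v::real_vector"
  assumes dim: "dim (UNIV :: 'v set) = 3"
    and yz: "y \<noteq> z" "independent {y, z}"
    and x: "x \<notin> span {y, z}"
  shows "ordered_basis UNIV [x, y, z]"
proof -
  have ne: "x \<noteq> y" "x \<noteq> z" using x span_base by blast+
  have ind: "independent {x, y, z}" using x yz(2) ne by (subst independent_insert) auto
  have "card {x, y, z} = 3" using ne yz by simp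
  then have "span {x, y, z} = UNIV"
    using span_eq_of_card_eq_dim[OF _ dim _ _ ind] by simp
  then show ?thesis using ne yz ind by (simp add: ordered_basis_def)
qed

section \<open>Brackets in coordinates\<close>

text \<open>A basis \<open>x, y, z\<close> in which the algebra is the semidirect product of the line spanned by
  \<open>x\<close> with the abelian plane spanned by \<open>y\<close> and \<open>z\<close>, where \<open>ad x\<close> acts on that plane by
  the matrix with columns \<open>(p, q)\<close> and \<open>(r, s)\<close>. The matrix may be singular, so the plane may be
  larger than the derived algebra.\<close>

definition semidirect_basis ::
  "('v::real_vector \<Rightarrow> 'v \<Rightarrow> 'v) \<Rightarrow> real \<Rightarrow> real \<Rightarrow> real \<Rightarrow> real \<Rightarrow> 'v \<Rightarrow> 'v \<Rightarrow> 'v \<Rightarrow> bool" where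
  "semidirect_basis br p q r s x y z \<longleftrightarrow> ordered_basis UNIV [x, y, z]
     \<and> br x y = p *\<^sub>R y + q *\<^sub>R z \<and> br x z = r *\<^sub>R y + s *\<^sub>R z \<and> br y z = 0"

context lie_algebra
begin

lemma linear_right: "linear (br u)" and linear_left: "linear (\<lambda>u. br u v)"
  using bilinear unfolding bilinear_def by auto

lemmas br_simps =
  linear_add[OF linear_right] linear_add[OF linear_left]
  linear_diff[OF linear_right] linear_diff[OF linear_left]
  linear_scale[OF linear_right] linear_scale[OF linear_left]
  linear_0[OF linear_right] linear_0[OF linear_left] alternating

lemma anticommute: "br u v = - br v u"
proof -
  have "br u u + br v u + (br u v + br v v) = 0"
    using alternating[of "u + v"]
    unfolding linear_add[OF linear_right] linear_add[OF linear_left] .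
  then have "br u v + br v u = 0" by (simp add: alternating add.commute)
  then show ?thesis by (simp add: eq_neg_iff_add_eq_0)
qed

lemma bracket_in_coordinates:
  "br (a *\<^sub>R x + b *\<^sub>R y + c *\<^sub>R z) (a' *\<^sub>R x + b' *\<^sub>R y + c' *\<^sub>R z)
     = (a * b' - b * a') *\<^sub>R br x y + (a * c' - c * a') *\<^sub>R br x z + (b * c' - c * b') *\<^sub>R br y z"
  using anticommute[of y x] anticommute[of z x] anticommute[of z y]
  by (simp add: br_simps algebra_simps)

lemma bracket_in_derived_algebra: "br u v \<in> derived_algebra br"
  by (auto simp: derived_algebra_def lie_product_def intro: span_base)

lemma subspace_derived_algebra: "subspace (derived_algebra br)"
  by (simp add: derived_algebra_def lie_product_def)

text \<open>The brackets of three spanning vectors suffice to bound the derived algebra.\<close>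

lemma derived_algebra_subset:
  assumes "subspace S" "span {x, y, z} = UNIV"
    and "br x y \<in> S" "br x z \<in> S" "br y z \<in> S"
  shows "derived_algebra br \<subseteq> S"
proof -
  have "br u v \<in> S" for u v
  proof -
    have "u \<in> span {x, y, z}" "v \<in> span {x, y, z}" using assms(2) by auto
    then obtain a b c a' b' c' where
      "u = a *\<^sub>R x + b *\<^sub>R y + c *\<^sub>R z" "v = a' *\<^sub>R x + b' *\<^sub>R y + c' *\<^sub>R z"
      unfolding in_span_triple by blast
    then show ?thesis
      using assms by (simp add: bracket_in_coordinates subspace_add subspace_scale)
  qed
  then show ?thesis
    unfolding derived_algebra_def lie_product_def using assms(1) by (intro span_minimal) auto
qed

lemma independent_pair_of_bracket_nonzero:
  assumes "br y z \<noteq> 0"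
  shows "y \<noteq> z" and "independent {y, z}"
proof -
  have "b = 0 \<and> c = 0" if *: "b *\<^sub>R y + c *\<^sub>R z = 0" for b c
  proof -
    have "b *\<^sub>R br y z = br (b *\<^sub>R y + c *\<^sub>R z) z" "c *\<^sub>R br y z = br y (b *\<^sub>R y + c *\<^sub>R z)"
      by (simp_all add: br_simps)
    then have "b *\<^sub>R br y z = 0" "c *\<^sub>R br y z = 0" unfolding * by (simp_all add: br_simps)
    then show ?thesis using assms by simp
  qed
  then show "y \<noteq> z" "independent {y, z}" using independent_pairI[of y z] by blast+
qed

end

lemma linear_bij_of_ordered_bases:
  fixes x y z :: "'v::real_vector" and x' y' z' :: "'w::real_vector"
  assumes B: "ordered_basis UNIV [x, y, z]" and C: "ordered_basis UNIV [x', y', z']"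
  shows "\<exists>f. linear f \<and> bij f \<and> f x = x' \<and> f y = y' \<and> f z = z'"
proof -
  have ext: "\<exists>f. linear f \<and> f u = u' \<and> f v = v' \<and> f w = w'"
    if b: "ordered_basis UNIV [u, v, w]"
    for u v w :: "'p::real_vector" and u' v' w' :: "'q::real_vector"
  proof -
    let ?g = "\<lambda>t. if t = u then u' else if t = v then v' else w'"
    have ind: "independent {u, v, w}" using b by (simp add: ordered_basis_def)
    obtain f where "linear f" "\<forall>t\<in>{u, v, w}. f t = ?g t"
      using linear_independent_extend[OF ind, of ?g] by blast
    then show ?thesis using b by (intro exI[of _ f]) (auto simp: ordered_basis_def)
  qed
  obtain f where f: "linear f" "f x = x'" "f y = y'" "f z = z'" using ext[OF B] by blast
  obtain g where g: "linear g" "g x' = x" "g y' = y" "g z' = z" using ext[OF C] by blast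
  have "g (f u) = u" for u
  proof -
    have "u \<in> span {x, y, z}" using B by (simp add: ordered_basis_def)
    then obtain a b c where "u = a *\<^sub>R x + b *\<^sub>R y + c *\<^sub>R z" unfolding in_span_triple by blast
    then show ?thesis using f g by (simp add: linear_add linear_scale)
  qed
  moreover have "f (g u) = u" for u
  proof -
    have "u \<in> span {x', y', z'}" using C by (simp add: ordered_basis_def)
    then obtain a b c where "u = a *\<^sub>R x' + b *\<^sub>R y' + c *\<^sub>R z'" unfolding in_span_triple by blast
    then show ?thesis using f g by (simp add: linear_add linear_scale)
  qed
  ultimately have "bij f" by (intro o_bij[of g]) auto
  then show ?thesis using f by blast
qed

lemma lie_isomorphic_of_semidirect_bases:
  assumes "lie_algebra G1" "lie_algebra G2"
    and B: "semidirect_basis G1 p q r s x y z" and C: "semidirect_basis G2 p q r s x' y' z'"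
  shows "lie_isomorphic G1 G2"
proof -
  interpret A1: lie_algebra G1 by fact
  interpret A2: lie_algebra G2 by fact
  obtain f where f: "linear f" "bij f" "f x = x'" "f y = y'" "f z = z'"
    using linear_bij_of_ordered_bases B C unfolding semidirect_basis_def by metis
  note lin = linear_add[OF f(1)] linear_scale[OF f(1)] linear_0[OF f(1)]
  have "f (G1 u v) = G2 (f u) (f v)" for u v
  proof -
    have "u \<in> span {x, y, z}" "v \<in> span {x, y, z}"
      using B by (simp_all add: semidirect_basis_def ordered_basis_def)
    then obtain a b c a' b' c' where
      "u = a *\<^sub>R x + b *\<^sub>R y + c *\<^sub>R z" "v = a' *\<^sub>R x + b' *\<^sub>R y + c' *\<^sub>R z"
      unfolding in_span_triple by blast
    then show ?thesis using B C
      by (simp add: A1.bracket_in_coordinates A2.bracket_in_coordinates lin f semidirect_basis_def)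
  qed
  then show ?thesis unfolding lie_isomorphic_def using f(1,2) by blast
qed

section \<open>The derived algebra of a solvable algebra is abelian\<close>

context lie_algebra
begin

lemma derived_algebra_neq_UNIV:
  assumes "solvable_lie br" "\<not> (UNIV :: 'a set) \<subseteq> {0}"
  shows "derived_algebra br \<noteq> UNIV"
proof
  assume "derived_algebra br = UNIV"
  then have "derived_series br n = UNIV" for n
    by (induction n) (auto simp: derived_algebra_def)
  then show False using assms unfolding solvable_lie_def by auto
qed

text \<open>In dimension three, a proper derived algebra that contains two independent vectors is the
  plane that they span.\<close>

lemma basis_of_plane:
  assumes dim: "dim (UNIV :: 'a set) = 3"
    and "X \<notin> derived_algebra br" "y \<in> derived_algebra br" "z \<in> derived_algebra br"
    and "y \<noteq> z" "independent {y, z}"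
  shows "ordered_basis UNIV [X, y, z]" "derived_algebra br = span {y, z}"
proof -
  let ?D = "derived_algebra br"
  have sub: "span {y, z} \<subseteq> ?D" using assms subspace_derived_algebra by (intro span_minimal) auto
  then show basis: "ordered_basis UNIV [X, y, z]"
    using assms by (intro ordered_basis_tripleI) auto
  have "u \<in> span {y, z}" if u: "u \<in> ?D" for u
  proof -
    have "u \<in> span {X, y, z}" using basis by (simp add: ordered_basis_def)
    then obtain a b c where abc: "u = a *\<^sub>R X + b *\<^sub>R y + c *\<^sub>R z" unfolding in_span_triple by blast
    then have "a *\<^sub>R X = u - (b *\<^sub>R y + c *\<^sub>R z)" by simp
    also have "\<dots> \<in> ?D"
      using u assms(3,4) subspace_derived_algebra by (intro subspace_diff subspace_add subspace_scale)
    finally have "a = 0" using assms(2) subspace_derived_algebra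
      by (metis subspace_scale scaleR_left_imp_eq scaleR_scaleR scaleR_one left_inverse)
    then show ?thesis using abc by (auto simp: in_span_pair)
  qed
  then show "?D = span {y, z}" using sub by blast
qed

lemma derived_algebra_abelian:
  assumes dim: "dim (UNIV :: 'a set) = 3" and solv: "solvable_lie br"
  shows "abelian_on br (derived_algebra br)"
proof (rule ccontr)
  let ?D = "derived_algebra br"
  assume "\<not> ?thesis"
  then obtain y z where yz: "y \<in> ?D" "z \<in> ?D" "br y z \<noteq> 0" unfolding abelian_on_def by blast
  then have "\<not> (UNIV :: 'a set) \<subseteq> {0}" by blast
  then obtain X where X: "X \<notin> ?D" using derived_algebra_neq_UNIV[OF solv] by blast
  note plane = basis_of_plane[OF dim X _ _ independent_pair_of_bracket_nonzero]
  define w where "w = br y z"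
  have wD: "w \<in> ?D" by (simp add: w_def bracket_in_derived_algebra)
  then obtain p q where w: "w = p *\<^sub>R y + q *\<^sub>R z"
    using plane(2)[OF yz(1,2,3,3)] by (auto simp: in_span_pair)
  have pq: "p\<^sup>2 + q\<^sup>2 \<noteq> 0" using w yz(3) by (auto simp: w_def sum_power2_eq_zero_iff)
  \<comment> \<open>The plane has a basis \<open>w, t\<close> with \<open>br w t = w\<close>.\<close>
  define t where "t = (1 / (p\<^sup>2 + q\<^sup>2)) *\<^sub>R (p *\<^sub>R z - q *\<^sub>R y)"
  have tD: "t \<in> ?D" unfolding t_def
    using yz subspace_derived_algebra by (intro subspace_diff subspace_scale)
  have "br w (p *\<^sub>R z - q *\<^sub>R y) = (p\<^sup>2 + q\<^sup>2) *\<^sub>R br y z"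
    using anticommute[of z y] by (simp add: w br_simps algebra_simps power2_eq_square)
  then have "br w t = (1 / (p\<^sup>2 + q\<^sup>2)) *\<^sub>R (p\<^sup>2 + q\<^sup>2) *\<^sub>R br y z"
    unfolding t_def linear_scale[OF linear_right] by (rule arg_cong)
  then have wt: "br w t = w" unfolding w_def using pq by (simp del: sum_power2_eq_zero_iff)
  have w0: "br w t \<noteq> 0" unfolding wt unfolding w_def by (rule yz(3))
  note basis = plane(1)[OF wD tD w0 w0] and D = plane(2)[OF wD tD w0 w0]
  obtain a b where Xw: "br X w = a *\<^sub>R w + b *\<^sub>R t"
    using bracket_in_derived_algebra[of X w] D by (auto simp: in_span_pair)
  obtain c d where Xt: "br X t = c *\<^sub>R w + d *\<^sub>R t"
    using bracket_in_derived_algebra[of X t] D by (auto simp: in_span_pair)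
  \<comment> \<open>Since \<open>ad X\<close> is a derivation, \<open>br X w = br (br X w) t + br w (br X t) = (a + d) w\<close>,
    which forces \<open>b = d = 0\<close>: every bracket is then a multiple of \<open>w\<close>.\<close>
  have "br X (br w t) = - br w (br t X) - br t (br X w)"
    using jacobi[of X w t] by (simp add: algebra_simps eq_neg_iff_add_eq_0)
  also have "\<dots> = br w (br X t) + br (br X w) t"
    using anticommute[of t X] anticommute[of t "br X w"]
    by (simp add: linear_neg[OF linear_right])
  also have "\<dots> = (a + d) *\<^sub>R w"
    by (simp add: Xw Xt br_simps wt algebra_simps)
  finally have "(- d) *\<^sub>R w + b *\<^sub>R t = 0" using wt Xw by (simp add: algebra_simps)
  then have "b = 0" "d = 0"
    using independent_pairD[OF independent_pair_of_bracket_nonzero[OF w0], of "- d" b] by simp_all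
  then have "br X w \<in> span {w}" "br X t \<in> span {w}" "br w t \<in> span {w}"
    using Xw Xt wt by (simp_all add: span_base span_scale)
  then have "?D \<subseteq> span {w}"
    using derived_algebra_subset[OF subspace_span, of X w t] basis
    by (simp add: ordered_basis_def)
  then obtain k where "t = k *\<^sub>R w" using tD by (auto simp: span_singleton)
  then show False using w0 by (simp add: br_simps)
qed

end

section \<open>One-dimensional derived algebra\<close>

text \<open>The first alternative is the Heisenberg algebra, whose derived algebra is central; the second
  is the direct product of the nonabelian algebra of dimension two with a line.\<close>

lemma (in lie_algebra) semidirect_basis_of_derived_line:
  assumes dim: "dim (UNIV :: 'a set) = 3" and D: "dim (derived_algebra br) = 1"
  shows "(\<exists>x y z. semidirect_basis br 0 1 0 0 x y z)
           \<and> dim (lie_centralizer br (derived_algebra br)) = 3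
       \<or> (\<exists>x y z. semidirect_basis br 1 0 0 0 x y z)
           \<and> dim (lie_centralizer br (derived_algebra br)) \<noteq> 3"
proof -
  let ?D = "derived_algebra br"
  let ?Z = "lie_centralizer br ?D"
  obtain B where B: "B \<subseteq> ?D" "independent B" "?D \<subseteq> span B" "card B = 1"
    using basis_exists[of ?D] D by metis
  obtain y where y: "B = {y}" using B(4) card_1_singletonE by blast
  have y0: "y \<noteq> 0" using B(2) y by (simp add: dependent_single)
  have D_multiple: "\<exists>k. br u v = k *\<^sub>R y" for u v
    using bracket_in_derived_algebra[of u v] B(3) y by (auto simp: span_singleton)
  have Z: "?Z = {w. br w y = 0}"
  proof -
    have "br w u = 0" if "br w y = 0" "u \<in> ?D" for w u
      using that B(3) y by (auto simp: span_singleton br_simps subset_iff)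
    then show ?thesis using B(1) y by (auto simp: lie_centralizer_def)
  qed
  have subZ: "subspace ?Z" unfolding Z by (auto simp: subspace_def br_simps)
  show ?thesis
  proof (cases "?Z = UNIV")
    case True
    then have central: "br u y = 0" for u using Z by auto
    have "\<not> ?D \<subseteq> {0}" using B(1) y y0 by auto
    then obtain u v where uv: "br u v \<noteq> 0"
      unfolding derived_algebra_def lie_product_def
      using span_minimal[of "{br x y | x y. x \<in> UNIV \<and> y \<in> UNIV}" "{0}"] by force
    have uv_central: "br w (br u v) = 0" for w
      using D_multiple[of u v] central by (auto simp: br_simps)
    have "u \<notin> span {v, br u v}"
    proof
      assume "u \<in> span {v, br u v}"
      then obtain b c where *: "u = b *\<^sub>R v + c *\<^sub>R br u v" by (auto simp: in_span_pair)
      have "br u v = br (b *\<^sub>R v + c *\<^sub>R br u v) v" using * by simp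
      also have "\<dots> = 0"
        using uv_central[of v] anticommute[of "br u v" v] by (simp add: br_simps)
      finally show False using uv by simp
    qed
    moreover have "v \<noteq> br u v \<and> independent {v, br u v}"
    proof (rule independent_pairI)
      fix b c assume *: "b *\<^sub>R v + c *\<^sub>R br u v = 0"
      have "b *\<^sub>R br u v = br u (b *\<^sub>R v + c *\<^sub>R br u v)"
        by (simp add: br_simps uv_central)
      then have "b = 0" using uv * by (simp add: br_simps)
      then show "b = 0 \<and> c = 0" using * uv by simp
    qed
    ultimately have "semidirect_basis br 0 1 0 0 u v (br u v)"
      using dim by (simp add: semidirect_basis_def ordered_basis_tripleI uv_central)
    then show ?thesis using True dim by auto
  next
    case False
    then obtain u where u: "br u y \<noteq> 0" using Z by auto
    obtain k where k: "br u y = k *\<^sub>R y" using D_multiple by blast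
    then have "k \<noteq> 0" using u by auto
    define x where "x = (1 / k) *\<^sub>R u"
    have xy: "br x y = y" using k \<open>k \<noteq> 0\<close> by (simp add: x_def br_simps)
    have ind: "x \<noteq> y \<and> independent {x, y}"
      using independent_pair_of_bracket_nonzero xy y0 by simp
    have "span {x, y} \<noteq> UNIV"
    proof
      assume "span {x, y} = UNIV"
      then have "dim (UNIV :: 'a set) = card {x, y}"
        using dim_unique[of "{x, y}" UNIV] ind by auto
      then show False using dim ind by simp
    qed
    then obtain z where z: "z \<notin> span {x, y}" by blast
    obtain m where m: "br x z = m *\<^sub>R y" using D_multiple by blast
    obtain n where n: "br y z = n *\<^sub>R y" using D_multiple by blast
    \<comment> \<open>The correction of \<open>z\<close> within the plane of \<open>x\<close> and \<open>y\<close> that makes it central.\<close>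
    define z' where "z' = z - m *\<^sub>R y + n *\<^sub>R x"
    have "z' \<notin> span {x, y}"
    proof
      assume "z' \<in> span {x, y}"
      then have "z' + (m *\<^sub>R y - n *\<^sub>R x) \<in> span {x, y}"
        by (intro span_add span_diff span_scale) (auto intro: span_base)
      then show False using z by (simp add: z'_def)
    qed
    then have basis: "ordered_basis UNIV [z', x, y]"
      using ordered_basis_tripleI[OF dim] ind by blast
    then have "ordered_basis UNIV [x, y, z']"
      by (auto simp: ordered_basis_def insert_commute)
    moreover have "br x z' = 0" "br y z' = 0"
      using m n xy anticommute[of y x] by (simp_all add: z'_def br_simps)
    ultimately have "semidirect_basis br 1 0 0 0 x y z'"
      using xy by (simp add: semidirect_basis_def)
    moreover have "dim ?Z \<noteq> 3"
    proof
      assume dimZ: "dim ?Z = 3"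
      obtain C where C: "C \<subseteq> ?Z" "independent C" "?Z \<subseteq> span C" "card C = 3"
        using basis_exists[of ?Z] dimZ by metis
      then have "span C = UNIV" using span_eq_of_card_eq_dim[OF _ dim] by auto
      moreover have "span C \<subseteq> ?Z" using C(1) subZ by (rule span_minimal)
      ultimately show False using False by auto
    qed
    ultimately show ?thesis by blast
  qed
qed

section \<open>Linear maps of a plane and their complex eigenvalues\<close>

text \<open>If no vector of \<open>V\<close> is cyclic, then \<open>T\<close> maps each vector to a multiple of itself. For a basis
  \<open>y, z\<close> the factors belonging to \<open>y\<close> and \<open>z\<close> then both agree with the one belonging to \<open>y + z\<close>.\<close>

lemma scalar_or_cyclic:
  fixes T :: "'v::real_vector \<Rightarrow> 'v"
  assumes T: "linear T" and inv: "T ` V \<subseteq> V" and V: "subspace V" "dim V = 2"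
  shows "(\<exists>l. \<forall>u\<in>V. T u = l *\<^sub>R u)
    \<or> (\<exists>v t d. v \<noteq> T v \<and> independent {v, T v} \<and> span {v, T v} = V
         \<and> T (T v) = t *\<^sub>R T v - d *\<^sub>R v)"
proof (rule disjCI)
  assume noncyclic: "\<not> (\<exists>v t d. v \<noteq> T v \<and> independent {v, T v} \<and> span {v, T v} = V
         \<and> T (T v) = t *\<^sub>R T v - d *\<^sub>R v)"
  have multiple: "\<exists>k. T v = k *\<^sub>R v" if v: "v \<in> V" for v
  proof (rule ccontr)
    assume no: "\<nexists>k. T v = k *\<^sub>R v"
    have "T v \<notin> span {v}" using no by (auto simp: span_singleton)
    moreover have "v \<noteq> 0" using no[simplified] linear_0[OF T] by auto
    moreover have ne: "v \<noteq> T v" using no by (metis scaleR_one)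
    ultimately have ind: "independent {v, T v}"
      by (subst insert_commute) (simp add: independent_insert)
    have "card {v, T v} = 2" using ne by simp
    then have sp: "span {v, T v} = V"
      using span_eq_of_card_eq_dim[OF V _ _ ind] v inv by auto
    have "T (T v) \<in> span {v, T v}" using sp v inv by blast
    then obtain b c where "T (T v) = b *\<^sub>R v + c *\<^sub>R T v" by (auto simp: in_span_pair)
    then have "T (T v) = c *\<^sub>R T v - (-b) *\<^sub>R v" by simp
    then show False using noncyclic ne ind sp by blast
  qed
  obtain B where B: "B \<subseteq> V" "independent B" "V \<subseteq> span B" "card B = 2"
    using basis_exists[of V] V(2) by metis
  then obtain y z where yz: "B = {y, z}" "y \<noteq> z" by (auto simp: card_2_iff)
  have inV: "y \<in> V" "z \<in> V" "y + z \<in> V" using B(1) yz subspace_add[OF V(1)] by auto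
  obtain k l m where k: "T y = k *\<^sub>R y" and l: "T z = l *\<^sub>R z" and m: "T (y + z) = m *\<^sub>R (y + z)"
    using multiple inV by metis
  then have "(k - m) *\<^sub>R y + (l - m) *\<^sub>R z = 0"
    by (simp add: linear_add[OF T] algebra_simps)
  then have "k = m" "l = m"
    using independent_pairD[OF yz(2), of "k - m" "l - m"] B(2) yz(1) by simp_all
  then have "T u = m *\<^sub>R u" if "u \<in> V" for u
    using that B(3) k l
    by (auto simp: yz(1) in_span_pair subset_iff linear_add[OF T] linear_scale[OF T] algebra_simps
        dest!: spec[of _ u])
  then show "\<exists>l. \<forall>u\<in>V. T u = l *\<^sub>R u" by blast
qed

lemma complex_eigenvalues_scalar:
  fixes T :: "'v::real_vector \<Rightarrow> 'v"
  assumes V: "subspace V" "dim V = 2" and T: "\<And>u. u \<in> V \<Longrightarrow> T u = l *\<^sub>R u"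
  shows "complex_eigenvalues V T = {complex_of_real l}"
    and "geometric_mult V T (complex_of_real l) = 2"
proof -
  obtain B where B: "B \<subseteq> V" "independent B" "V \<subseteq> span B" "card B = 2"
    using basis_exists[of V] V(2) by metis
  then obtain y z where yz: "B = {y, z}" "y \<noteq> z" by (auto simp: card_2_iff)
  have inV: "y \<in> V" "z \<in> V" using B(1) yz by auto
  have y0: "y \<noteq> 0" using B(2) yz dependent_zero by blast
  have T_cscale: "map_prod T T w = cscale (complex_of_real l) w" if "w \<in> V \<times> V" for w
    using that T by (auto simp: cscale_def)
  have E: "complex_eigenspace V T (complex_of_real l) = V \<times> V"
    using T_cscale by (auto simp: complex_eigenspace_def)
  show "complex_eigenvalues V T = {complex_of_real l}"
  proof (intro equalityI subsetI)
    fix c assume "c \<in> complex_eigenvalues V T"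
    then obtain w where w: "w \<in> V \<times> V" "map_prod T T w = cscale c w" "w \<noteq> 0"
      by (auto simp: complex_eigenvalues_def complex_eigenspace_def)
    then have "cscale c w = cscale (complex_of_real l) w" using T_cscale by metis
    then show "c \<in> {complex_of_real l}" using w(3) by simp
  next
    fix c assume "c \<in> {complex_of_real l}"
    moreover have "(y, 0) \<in> V \<times> V" "(y, 0) \<noteq> (0 :: 'v \<times> 'v)"
      using inV y0 V(1) by (auto simp: subspace_0 zero_prod_def)
    ultimately show "c \<in> complex_eigenvalues V T" using E by (auto simp: complex_eigenvalues_def)
  qed
  let ?C = "{(y, 0), (z, 0)} :: ('v \<times> 'v) set"
  have combo: "u \<in> cplx.span ?C \<longleftrightarrow> (\<exists>b c. u = cscale b (y, 0) + cscale c (z, 0))" for u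
  proof -
    have "u \<in> cplx.span ?C \<longleftrightarrow> (\<exists>b c. u - cscale b (y, 0) = cscale c (z, 0))"
      by (auto simp: cplx.span_insert[of "(y, 0)"] cplx.span_singleton)
    then show ?thesis by (simp add: algebra_simps)
  qed
  have "V \<times> V \<subseteq> cplx.span ?C"
  proof
    fix w assume "w \<in> V \<times> V"
    then have "fst w \<in> span {y, z}" "snd w \<in> span {y, z}" using B(3) yz(1) by auto
    then obtain b c b' c' where
      "fst w = b *\<^sub>R y + c *\<^sub>R z" "snd w = b' *\<^sub>R y + c' *\<^sub>R z"
      unfolding in_span_pair by blast
    then have "w = cscale (Complex b b') (y, 0) + cscale (Complex c c') (z, 0)"
      by (simp add: cscale_def prod_eq_iff)
    then show "w \<in> cplx.span ?C" using combo by blast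
  qed
  moreover have "cplx.independent ?C"
  proof -
    have "(y, 0) \<notin> cplx.span {(z, 0 :: 'v)}"
    proof
      assume "(y, 0) \<in> cplx.span {(z, 0 :: 'v)}"
      then obtain c where "(y, 0) = cscale c (z, 0 :: 'v)" by (auto simp: cplx.span_singleton)
      then have "1 *\<^sub>R y + (- Re c) *\<^sub>R z = 0" by (simp add: cscale_def)
      then show False using independent_pairD[OF yz(2)] B(2) yz(1) by fastforce
    qed
    moreover have "z \<noteq> 0" using B(2) yz dependent_zero by blast
    ultimately show ?thesis using yz(2) by (simp add: cplx.independent_insert zero_prod_def)
  qed
  moreover have "?C \<subseteq> V \<times> V" "card ?C = 2"
    using inV V(1) yz(2) by (auto simp: subspace_0)
  ultimately show "geometric_mult V T (complex_of_real l) = 2"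
    unfolding geometric_mult_def E by (intro cplx.dim_unique[of ?C])
qed

text \<open>With complex coefficients, \<open>p v + q T v\<close> lies in the eigenspace of \<open>c\<close> precisely if
  \<open>p = q (c - t)\<close> and \<open>- q d = c p\<close>. That eigenspace is therefore the complex line through
  \<open>(c - t) v + T v\<close> if \<open>c\<close> is a root of the characteristic polynomial, and zero otherwise.\<close>

lemma complex_eigenvalues_cyclic:
  fixes T :: "'v::real_vector \<Rightarrow> 'v"
  assumes T: "linear T" and ne: "v \<noteq> T v" and ind: "independent {v, T v}"
    and V: "span {v, T v} = V" and TT: "T (T v) = t *\<^sub>R T v - d *\<^sub>R v"
  shows "complex_eigenvalues V T
           = {c. c\<^sup>2 - complex_of_real t * c + complex_of_real d = 0}"
    and "geometric_mult V T c \<le> 1"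
proof -
  have indD: "b = 0" "c = 0" if "b *\<^sub>R v + c *\<^sub>R T v = 0" for b c
    using independent_pairD[OF ne ind that] by auto
  have eigenvector: "\<exists>q. w = cscale q (cscale (c - complex_of_real t) (v, 0) + (T v, 0))
      \<and> q * (c\<^sup>2 - complex_of_real t * c + complex_of_real d) = 0"
    if "w \<in> complex_eigenspace V T c" for w c
  proof -
    have "fst w \<in> span {v, T v}" "snd w \<in> span {v, T v}"
      using that V by (auto simp: complex_eigenspace_def)
    then obtain p q p' q' where
      w: "fst w = p *\<^sub>R v + q *\<^sub>R T v" "snd w = p' *\<^sub>R v + q' *\<^sub>R T v"
      unfolding in_span_pair by blast
    have eq: "T (fst w) = Re c *\<^sub>R fst w - Im c *\<^sub>R snd w"
      "T (snd w) = Re c *\<^sub>R snd w + Im c *\<^sub>R fst w"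
      using that by (auto simp: complex_eigenspace_def cscale_def prod_eq_iff)
    have "(- q * d - Re c * p + Im c * p') *\<^sub>R v
        + (p + q * t - Re c * q + Im c * q') *\<^sub>R T v = 0"
      using eq(1) unfolding w
      by (simp add: linear_add[OF T] linear_scale[OF T] TT algebra_simps)
    note 1 = indD[OF this]
    have "(- q' * d - Re c * p' - Im c * p) *\<^sub>R v
        + (p' + q' * t - Re c * q' - Im c * q) *\<^sub>R T v = 0"
      using eq(2) unfolding w
      by (simp add: linear_add[OF T] linear_scale[OF T] TT algebra_simps)
    note 2 = indD[OF this]
    have p: "Complex p p' = Complex q q' * (c - complex_of_real t)"
      using 1(2) 2(2) by (simp add: complex_eq_iff algebra_simps)
    have "- Complex q q' * complex_of_real d = c * Complex p p'"
      using 1(1) 2(1) by (simp add: complex_eq_iff algebra_simps)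
    then have "Complex q q' * (c\<^sup>2 - complex_of_real t * c + complex_of_real d) = 0"
      unfolding p by (simp add: algebra_simps power2_eq_square)
    moreover have "w = cscale (Complex p p') (v, 0) + cscale (Complex q q') (T v, 0)"
      using w by (simp add: cscale_def prod_eq_iff)
    then have "w = cscale (Complex q q') (cscale (c - complex_of_real t) (v, 0) + (T v, 0))"
      unfolding p by (simp add: cplx.scale_right_distrib)
    ultimately show ?thesis by blast
  qed
  show "complex_eigenvalues V T = {c. c\<^sup>2 - complex_of_real t * c + complex_of_real d = 0}"
  proof (intro equalityI subsetI)
    fix c assume "c \<in> complex_eigenvalues V T"
    then obtain w where w: "w \<in> complex_eigenspace V T c" "w \<noteq> 0"
      by (auto simp: complex_eigenvalues_def)
    then show "c \<in> {c. c\<^sup>2 - complex_of_real t * c + complex_of_real d = 0}"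
      using eigenvector[OF w(1)] by auto
  next
    fix c assume "c \<in> {c. c\<^sup>2 - complex_of_real t * c + complex_of_real d = 0}"
    then have c: "c * (c - complex_of_real t) = - complex_of_real d"
      by (simp add: algebra_simps power2_eq_square eq_neg_iff_add_eq_0)
    define w where "w = cscale (c - complex_of_real t) (v, 0) + (T v, 0)"
    have "cscale c w = cscale (c * (c - complex_of_real t)) (v, 0) + cscale c (T v, 0)"
      by (simp add: w_def cplx.scale_right_distrib)
    also have "\<dots> = map_prod T T w"
      unfolding c by (simp add: w_def cscale_def linear_add[OF T] linear_diff[OF T]
          linear_scale[OF T] linear_0[OF T] TT algebra_simps)
    finally have "map_prod T T w = cscale c w" ..
    moreover have "v \<in> V" "T v \<in> V" "subspace V"
      using V span_base[of _ "{v, T v}"] by auto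
    then have "w \<in> V \<times> V"
      by (auto simp: w_def cscale_def subspace_0 intro!: subspace_add subspace_scale)
    moreover have "w \<noteq> 0"
    proof
      assume "w = 0"
      then have "fst w = 0" by simp
      then have "(Re c - t) *\<^sub>R v + 1 *\<^sub>R T v = 0" by (simp add: w_def cscale_def)
      then show False using indD(2) by fastforce
    qed
    ultimately show "c \<in> complex_eigenvalues V T"
      unfolding complex_eigenvalues_def complex_eigenspace_def by blast
  qed
  let ?w = "cscale (c - complex_of_real t) (v, 0) + (T v, 0)"
  have "complex_eigenspace V T c \<subseteq> cplx.span {?w}"
    using eigenvector unfolding cplx.span_singleton by blast
  then have "cplx.dim (complex_eigenspace V T c) \<le> card {?w}"
    by (intro cplx.dim_le_card) auto
  then show "geometric_mult V T c \<le> 1" by (simp add: geometric_mult_def)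
qed

lemma quadratic_roots_determine_coefficients:
  fixes t d t' d' :: complex
  assumes eq: "{c. c\<^sup>2 - t * c + d = 0} = {c. c\<^sup>2 - t' * c + d' = 0}"
  shows "t = t' \<and> d = d'"
proof -
  have split: "\<exists>r s. t = r + s \<and> d = r * s \<and> {c. c\<^sup>2 - t * c + d = 0} = {r, s}" for t d :: complex
  proof -
    define e where "e = csqrt (t\<^sup>2 - 4 * d)"
    let ?r = "(t + e) / 2" and ?s = "(t - e) / 2"
    have e: "e * e = t * t - 4 * d" by (simp add: e_def flip: power2_eq_square)
    have d: "d = ?r * ?s" using e by (simp add: field_simps)
    have "c\<^sup>2 - t * c + d = (c - ?r) * (c - ?s)" for c
      using e by (simp add: field_simps power2_eq_square)
    then have "{c. c\<^sup>2 - t * c + d = 0} = {?r, ?s}" by auto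
    moreover have "t = ?r + ?s" by (simp add: field_simps)
    ultimately show ?thesis using d by blast
  qed
  obtain r s r' s' where "t = r + s" "d = r * s" "t' = r' + s'" "d' = r' * s'" "{r, s} = {r', s'}"
    using split[of t d] split[of t' d'] eq by metis
  then show ?thesis by (auto simp: doubleton_eq_iff)
qed

section \<open>Two-dimensional derived algebra\<close>

lemma (in lie_algebra) semidirect_basis_of_derived_plane:
  assumes dim: "dim (UNIV :: 'a set) = 3" and solv: "solvable_lie br"
    and D: "dim (derived_algebra br) = 2" and X: "X \<notin> derived_algebra br"
  shows "(\<exists>l y z. semidirect_basis br l 0 0 l X y z
            \<and> complex_eigenvalues (derived_algebra br) (ad br X) = {complex_of_real l}
            \<and> geometric_mult (derived_algebra br) (ad br X) (complex_of_real l) = 2)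
       \<or> (\<exists>t d y z. semidirect_basis br 0 1 (- d) t X y z
            \<and> complex_eigenvalues (derived_algebra br) (ad br X)
                = {c. c\<^sup>2 - complex_of_real t * c + complex_of_real d = 0}
            \<and> (\<forall>c. geometric_mult (derived_algebra br) (ad br X) c \<le> 1))"
proof -
  let ?D = "derived_algebra br" and ?T = "ad br X"
  have abelian: "br u v = 0" if "u \<in> ?D" "v \<in> ?D" for u v
    using derived_algebra_abelian[OF dim solv] that by (auto simp: abelian_on_def)
  have T: "linear ?T" by (simp add: ad_def linear_right)
  have inv: "?T ` ?D \<subseteq> ?D" by (auto simp: ad_def bracket_in_derived_algebra)
  from scalar_or_cyclic[OF T inv subspace_derived_algebra D] show ?thesis
  proof (elim disjE exE conjE)
    fix l assume l: "\<forall>u\<in>?D. ?T u = l *\<^sub>R u"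
    obtain B where B: "B \<subseteq> ?D" "independent B" "card B = 2"
      using basis_exists[of ?D] D by metis
    then obtain y z where yz: "B = {y, z}" "y \<noteq> z" by (auto simp: card_2_iff)
    have "ordered_basis UNIV [X, y, z]"
      using basis_of_plane(1)[OF dim X] B yz by auto
    then have "semidirect_basis br l 0 0 l X y z"
      using l B(1) yz abelian by (auto simp: semidirect_basis_def ad_def)
    then show ?thesis
      using complex_eigenvalues_scalar[OF subspace_derived_algebra D, of ?T l] l by blast
  next
    fix v t d
    assume ne: "v \<noteq> ?T v" and ind: "independent {v, ?T v}" and sp: "span {v, ?T v} = ?D"
      and TT: "?T (?T v) = t *\<^sub>R ?T v - d *\<^sub>R v"
    have vD: "v \<in> ?D" "?T v \<in> ?D" using sp span_base[of _ "{v, ?T v}"] by auto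
    have "ordered_basis UNIV [X, v, ?T v]"
      by (rule basis_of_plane(1)[OF dim X vD ne ind])
    then have "semidirect_basis br 0 1 (- d) t X v (?T v)"
      using TT abelian[OF vD] by (simp add: semidirect_basis_def ad_def)
    then show ?thesis
      using complex_eigenvalues_cyclic[OF T ne ind sp TT] by blast
  qed
qed

section \<open>Classification by the derived algebra\<close>

theorem theorem2p1:
  shows
    "(\<forall>G :: 'g::real_vector \<Rightarrow> 'g \<Rightarrow> 'g.
        lie_algebra G \<longrightarrow> dim (UNIV :: 'g set) = 3 \<longrightarrow> solvable_lie G \<longrightarrow>
        abelian_on G (derived_algebra G))
   \<and> (\<forall>(G1 :: 'a::real_vector \<Rightarrow> 'a \<Rightarrow> 'a) (G2 :: 'b::real_vector \<Rightarrow> 'b \<Rightarrow> 'b).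
        lie_algebra G1 \<longrightarrow> dim (UNIV :: 'a set) = 3 \<longrightarrow> solvable_lie G1 \<longrightarrow>
        lie_algebra G2 \<longrightarrow> dim (UNIV :: 'b set) = 3 \<longrightarrow> solvable_lie G2 \<longrightarrow>
        dim (derived_algebra G1) = 2 \<longrightarrow> dim (derived_algebra G2) = 2 \<longrightarrow>
        (\<exists>X1 X2. X1 \<notin> derived_algebra G1 \<and> X2 \<notin> derived_algebra G2 \<and>
           same_eigenvalues_and_mults (derived_algebra G1) (ad G1 X1)
                                      (derived_algebra G2) (ad G2 X2)) \<longrightarrow>
        lie_isomorphic G1 G2)
   \<and> (\<forall>(G1 :: 'a::real_vector \<Rightarrow> 'a \<Rightarrow> 'a) (G2 :: 'b::real_vector \<Rightarrow> 'b \<Rightarrow> 'b).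
        lie_algebra G1 \<longrightarrow> dim (UNIV :: 'a set) = 3 \<longrightarrow> solvable_lie G1 \<longrightarrow>
        lie_algebra G2 \<longrightarrow> dim (UNIV :: 'b set) = 3 \<longrightarrow> solvable_lie G2 \<longrightarrow>
        dim (derived_algebra G1) = 1 \<longrightarrow> dim (derived_algebra G2) = 1 \<longrightarrow>
        dim (lie_centralizer G1 (derived_algebra G1))
          = dim (lie_centralizer G2 (derived_algebra G2)) \<longrightarrow>
        lie_isomorphic G1 G2)"
proof (intro conjI allI impI)
  fix G :: "'g::real_vector \<Rightarrow> 'g \<Rightarrow> 'g"
  assume "lie_algebra G" "dim (UNIV :: 'g set) = 3" "solvable_lie G"
  then show "abelian_on G (derived_algebra G)" by (rule lie_algebra.derived_algebra_abelian)
next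
  fix G1 :: "'a::real_vector \<Rightarrow> 'a \<Rightarrow> 'a" and G2 :: "'b::real_vector \<Rightarrow> 'b \<Rightarrow> 'b"
  assume 1: "lie_algebra G1" "dim (UNIV :: 'a set) = 3" "solvable_lie G1"
    and 2: "lie_algebra G2" "dim (UNIV :: 'b set) = 3" "solvable_lie G2"
    and D: "dim (derived_algebra G1) = 2" "dim (derived_algebra G2) = 2"
    and "\<exists>X1 X2. X1 \<notin> derived_algebra G1 \<and> X2 \<notin> derived_algebra G2 \<and>
           same_eigenvalues_and_mults (derived_algebra G1) (ad G1 X1)
                                      (derived_algebra G2) (ad G2 X2)"
  then obtain X1 X2 where X: "X1 \<notin> derived_algebra G1" "X2 \<notin> derived_algebra G2"
    and same: "same_eigenvalues_and_mults (derived_algebra G1) (ad G1 X1)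
                                      (derived_algebra G2) (ad G2 X2)" by blast
  let ?E1 = "complex_eigenvalues (derived_algebra G1) (ad G1 X1)"
  let ?E2 = "complex_eigenvalues (derived_algebra G2) (ad G2 X2)"
  let ?g1 = "geometric_mult (derived_algebra G1) (ad G1 X1)"
  let ?g2 = "geometric_mult (derived_algebra G2) (ad G2 X2)"
  have E: "?E1 = ?E2" and g: "\<And>c. c \<in> ?E1 \<Longrightarrow> ?g1 c = ?g2 c"
    using same by (auto simp: same_eigenvalues_and_mults_def)
  note iso = lie_isomorphic_of_semidirect_bases[OF 1(1) 2(1)]
  consider (scalar1) l y z where "semidirect_basis G1 l 0 0 l X1 y z"
      "?E1 = {complex_of_real l}" "?g1 (complex_of_real l) = 2"
    | (cyclic1) t d y z where "semidirect_basis G1 0 1 (- d) t X1 y z"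
      "?E1 = {c. c\<^sup>2 - complex_of_real t * c + complex_of_real d = 0}" "\<And>c. ?g1 c \<le> 1"
    using lie_algebra.semidirect_basis_of_derived_plane[OF 1 D(1) X(1)] by blast
  note cases1 = this
  consider (scalar2) l y z where "semidirect_basis G2 l 0 0 l X2 y z"
      "?E2 = {complex_of_real l}" "?g2 (complex_of_real l) = 2"
    | (cyclic2) t d y z where "semidirect_basis G2 0 1 (- d) t X2 y z"
      "?E2 = {c. c\<^sup>2 - complex_of_real t * c + complex_of_real d = 0}" "\<And>c. ?g2 c \<le> 1"
    using lie_algebra.semidirect_basis_of_derived_plane[OF 2 D(2) X(2)] by blast
  note cases2 = this
  show "lie_isomorphic G1 G2"
  proof (cases rule: cases1)
    case s1: (scalar1 l y z)
    show ?thesis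
    proof (cases rule: cases2)
      case s2: (scalar2 l' y' z')
      then have "l = l'" using s1 E by auto
      then show ?thesis using iso[OF s1(1)] s2(1) by simp
    next
      case (cyclic2 t d y' z')
      then have "?g1 (complex_of_real l) \<le> 1" using g s1(2) by simp
      then show ?thesis using s1(3) by simp
    qed
  next
    case c1: (cyclic1 t d y z)
    show ?thesis
    proof (cases rule: cases2)
      case (scalar2 l y' z')
      then have "?g2 (complex_of_real l) \<le> 1"
        using g[of "complex_of_real l"] c1(3) E by (metis singletonI)
      then show ?thesis using scalar2(3) by simp
    next
      case c2: (cyclic2 t' d' y' z')
      then have "{c. c\<^sup>2 - complex_of_real t * c + complex_of_real d = 0}
          = {c. c\<^sup>2 - complex_of_real t' * c + complex_of_real d' = 0}" using E c1(2) by simp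
      then have "t = t'" "d = d'"
        using quadratic_roots_determine_coefficients[of "complex_of_real t" "complex_of_real d"
            "complex_of_real t'" "complex_of_real d'"] by simp_all
      then show ?thesis using iso[OF c1(1)] c2(1) by simp
    qed
  qed
next
  fix G1 :: "'a::real_vector \<Rightarrow> 'a \<Rightarrow> 'a" and G2 :: "'b::real_vector \<Rightarrow> 'b \<Rightarrow> 'b"
  assume 1: "lie_algebra G1" "dim (UNIV :: 'a set) = 3"
    and 2: "lie_algebra G2" "dim (UNIV :: 'b set) = 3"
    and D: "dim (derived_algebra G1) = 1" "dim (derived_algebra G2) = 1"
    and Z: "dim (lie_centralizer G1 (derived_algebra G1))
          = dim (lie_centralizer G2 (derived_algebra G2))"
  note iso = lie_isomorphic_of_semidirect_bases[OF 1(1) 2(1)]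
  show "lie_isomorphic G1 G2"
    using lie_algebra.semidirect_basis_of_derived_line[OF 1 D(1)]
      lie_algebra.semidirect_basis_of_derived_line[OF 2 D(2)]
    unfolding Z using iso by blast
qed

end
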